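(* The following are equivalent. (1) $\ell(n,6)\ne0$ for any $n\ge6$. (2) The (strong) Goldbach conjecture holds: every even integer greater than $2$ is the sum of two primes.
   Context: For $n\ge6$, $\ell(n,6)$ is the number of compositions $(\lambda_1,\dots,\lambda_6)\in\mathbb Z_{>0}^6$ with $\lambda_1+\dots+\lambda_6=n$ such that $\lambda_i+\lambda_{i+1}$ is a prime number for all $i=1,\dots,5$. *)

theory Defs
  imports "HOL-Computational_Algebra.Primes"
begin

definition compositions :: "nat \<Rightarrow> nat \<Rightarrow> nat list set" where
  "compositions n k = {xs. length xs = k \<and> (\<forall>x \<in> set xs. x > 0) \<and> sum_list xs = n}"

(* The parts are indexed from 0, so the entries xs ! i and xs ! (i + 1) with i + 1 < k
   are the k - 1 pairs of neighbouring parts. *)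
definition prime_compositions :: "nat \<Rightarrow> nat \<Rightarrow> nat list set" where
  "prime_compositions n k =
     {xs \<in> compositions n k. \<forall>i. i + 1 < k \<longrightarrow> prime (xs ! i + xs ! (i + 1))}"

definition ell :: "nat \<Rightarrow> nat \<Rightarrow> nat" where
  "ell n k = card (prime_compositions n k)"

(* card is 0 on infinite sets; the following shows that ell is a genuine count. *)
lemma finite_prime_compositions: "finite (prime_compositions n k)"
proof (rule finite_subset)
  show "prime_compositions n k \<subseteq> {xs. set xs \<subseteq> {..n} \<and> length xs = k}"
    by (auto simp: prime_compositions_def compositions_def intro: member_le_sum_list)
  show "finite {xs. set xs \<subseteq> {..n} \<and> length xs = k}"
    by (rule finite_lists_length_eq) simp
qed

definition goldbach_conjecture :: bool where
  "goldbach_conjecture \<longleftrightarrow>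
     (\<forall>m::nat. even m \<and> m > 2 \<longrightarrow> (\<exists>p q. prime p \<and> prime q \<and> m = p + q))"

end

theory Submission
  imports Defs
begin

text \<open>
  A composition \<open>(a, b, c, d, e, f)\<close> of \<open>n\<close> splits into the three blocks \<open>a + b\<close>, \<open>c + d\<close>,
  \<open>e + f\<close>, so a prime composition writes \<open>n\<close> as a sum of three primes. For even \<open>n\<close> one of them
  must be \<open>2\<close> by parity, and \<open>n - 2\<close> is then a sum of two primes; this is the Goldbach conjecture,
  since \<open>n - 2\<close> runs through all even numbers greater than \<open>2\<close>
  (\<open>goldbach_from_even_prime_composition\<close>).

  Conversely, let \<open>n - 2\<close> (for even \<open>n\<close>) or \<open>n - 3\<close> (for odd \<open>n\<close>) be \<open>p + q\<close> with \<open>p\<close> and \<open>q\<close>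
  prime. The third prime \<open>2\<close> or \<open>3\<close> is \<open>x + 1\<close> with \<open>x = 1\<close> or \<open>x = 2\<close>. Putting a \<open>1\<close> first in each of
  the blocks \<open>p = 1 + (p - 1)\<close> and \<open>q = 1 + (q - 1)\<close> makes the sums across the block boundaries
  prime as well: they are \<open>1 + 1 = 2\<close> and \<open>(p - 1) + 1 = p\<close>
  (\<open>prime_composition_from_two_primes\<close>).
\<close>

lemma ell_nonzero_iff: "ell n k \<noteq> 0 \<longleftrightarrow> prime_compositions n k \<noteq> {}"
  by (simp add: ell_def finite_prime_compositions)

lemma prime_compositions_six_iff:
  "[a, b, c, d, e, f] \<in> prime_compositions n 6 \<longleftrightarrow>
     a > 0 \<and> b > 0 \<and> c > 0 \<and> d > 0 \<and> e > 0 \<and> f > 0 \<and> a + b + c + d + e + f = n \<and>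
     prime (a + b) \<and> prime (b + c) \<and> prime (c + d) \<and> prime (d + e) \<and> prime (e + f)"
proof -
  have "i + 1 < 6 \<longleftrightarrow> i \<in> {0, 1, 2, 3, 4}" for i :: nat
    by auto
  then show ?thesis
    by (auto simp: prime_compositions_def compositions_def add.assoc)
qed

lemma even_sum_of_three_primes:
  fixes p q r :: nat
  assumes "prime p" "prime q" "prime r" "even (p + q + r)"
  shows "p = 2 \<or> q = 2 \<or> r = 2"
  using assms primes_dvd_imp_eq two_is_prime_nat by (metis even_add)

lemma goldbach_from_even_prime_composition:
  fixes m :: nat
  assumes "even m" "prime_compositions (m + 2) 6 \<noteq> {}"
  shows "\<exists>p q. prime p \<and> prime q \<and> m = p + q"
proof -
  obtain xs where xs: "xs \<in> prime_compositions (m + 2) 6"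
    using assms(2) by blast
  then have "length xs = 6"
    by (simp add: prime_compositions_def compositions_def)
  then obtain a b c d e f where "xs = [a, b, c, d, e, f]"
    by (auto simp: numeral_eq_Suc length_Suc_conv)
  with xs have primes: "prime (a + b)" "prime (c + d)" "prime (e + f)"
    and sum: "(a + b) + (c + d) + (e + f) = m + 2"
    by (simp_all add: prime_compositions_six_iff)
  have "even ((a + b) + (c + d) + (e + f))"
    unfolding sum using \<open>even m\<close> by simp
  then consider "a + b = 2" | "c + d = 2" | "e + f = 2"
    using even_sum_of_three_primes primes by blast
  then show ?thesis
  proof cases
    case 1
    then have "m = (c + d) + (e + f)" using sum by simp
    then show ?thesis using primes by blast
  next
    case 2
    then have "m = (a + b) + (e + f)" using sum by simp
    then show ?thesis using primes by blast
  next
    case 3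
    then have "m = (a + b) + (c + d)" using sum by simp
    then show ?thesis using primes by blast
  qed
qed

lemma prime_composition_from_two_primes:
  fixes p q x :: nat
  assumes "prime p" "prime q" "prime (x + 1)"
  shows "[x, 1, 1, p - 1, 1, q - 1] \<in> prime_compositions (x + 1 + p + q) 6"
proof -
  have "p > 1" "q > 1" "x > 0"
    using assms prime_gt_1_nat[of p] prime_gt_1_nat[of q] prime_gt_1_nat[of "x + 1"] by auto
  then show ?thesis
    unfolding prime_compositions_six_iff using assms by (simp flip: numeral_2_eq_2)
qed

theorem theorem6p14:
  shows "(\<forall>n::nat. n \<ge> 6 \<longrightarrow> ell n 6 \<noteq> 0) \<longleftrightarrow> goldbach_conjecture"
proof
  assume compositions: "\<forall>n::nat. n \<ge> 6 \<longrightarrow> ell n 6 \<noteq> 0"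
  show goldbach_conjecture
    unfolding goldbach_conjecture_def
  proof (intro allI impI)
    fix m :: nat
    assume m: "even m \<and> m > 2"
    then have "m + 2 \<ge> 6" by presburger
    then have "prime_compositions (m + 2) 6 \<noteq> {}"
      using compositions ell_nonzero_iff by blast
    then show "\<exists>p q. prime p \<and> prime q \<and> m = p + q"
      using goldbach_from_even_prime_composition m by blast
  qed
next
  assume goldbach: goldbach_conjecture
  show "\<forall>n::nat. n \<ge> 6 \<longrightarrow> ell n 6 \<noteq> 0"
  proof (intro allI impI)
    fix n :: nat
    assume n: "n \<ge> 6"
    \<comment> \<open>The parity of \<open>x + 1\<close> is that of \<open>n\<close>, and \<open>n - (x + 1) \<ge> 4\<close> because an odd \<open>n\<close> is at least \<open>7\<close>.\<close>
    define x :: nat where "x = (if even n then 1 else 2)"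
    have x: "prime (x + 1)"
      by (simp add: x_def flip: numeral_2_eq_2)
    have "even (n - (x + 1)) \<and> n - (x + 1) > 2"
      using n unfolding x_def by presburger
    then obtain p q where pq: "prime p" "prime q" "n - (x + 1) = p + q"
      using goldbach unfolding goldbach_conjecture_def by blast
    then have "n = x + 1 + p + q"
      using n by (simp add: x_def split: if_splits)
    then have "prime_compositions n 6 \<noteq> {}"
      using prime_composition_from_two_primes[OF pq(1,2) x] by blast
    then show "ell n 6 \<noteq> 0"
      unfolding ell_nonzero_iff .
  qed
qed

end
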